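(* Let $F$ be a natural exponential family on $\mathbb{R}$ and let $\mu$ be a fixed probability in $F$ with mean $m_o$. Let $f_\mu(x,m)=\exp\{\psi_\mu(m)x-k_\mu(\psi_\mu(m))\}$ for $x\in\mathbb{R}$, $m\in M_F$, and let $P_n(x)=\frac{\partial^n}{\partial m^n}f_\mu(x,m)\big|_{m=m_o}$ for $n\in\mathbb{N}$ (a polynomial in $x$ of degree $n$). Then $$\sum_{n\in\mathbb{N}}\frac{(m-m_o)^n}{n!}P_n(x)$$ is a power series in $(m-m_o)$ with coefficients in $L^2(\mu)$ whose radius of convergence is nonzero.
   Context: $\mathbb{N}=\{0,1,2,\dots\}$. For a positive Radon measure $\nu$ on $\mathbb{R}$, let $L_\nu(\theta)=\int_{\mathbb{R}}\exp(\theta x)\,\nu(dx)\le+\infty$, and let $\Theta(\nu)$ be the interior of $\{\theta\in\mathbb{R}: L_\nu(\theta)<\infty\}$. $\mathcal{M}(\mathbb{R})$ is the set of such $\nu$ with $\Theta(\nu)\neq\emptyset$ and $\nu$ not concentrated on one point. For $\nu\in\mathcal{M}(\mathbb{R})$ put $k_\nu=\log L_\nu$ on $\Theta(\nu)$; it is strictly convex and real analytic. For $\theta\in\Theta(\nu)$ let $P(\theta,\nu)(dx)=\exp(\theta x-k_\nu(\theta))\,\nu(dx)$. The natural exponential family (NEF) generated by $\nu$ is $F=F(\nu)=\{P(\theta,\nu):\theta\in\Theta(\nu)\}$. Its domain of the means is the open interval $M_F=k_\nu'(\Theta(\nu))$, and $\psi_\nu:M_F\to\Theta(\nu)$ is the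 inverse of $k_\nu'$. Any element $\mu$ of $F$ itself generates $F$ (i.e. $F(\mu)=F$), so $k_\mu$ and $\psi_\mu$ are defined in the same way with $\nu=\mu$; if $\mu$ has mean $m_o$ then $m_o\in M_F$, $0\in\Theta(\mu)$, $\psi_\mu(m_o)=0$ and $f_\mu(\cdot,m_o)\equiv1$. The power series having nonzero radius of convergence in $L^2(\mu)$ means that there is $r>0$ such that $\sum_{n}\|P_n\|_{L^2(\mu)}\,\frac{|m-m_o|^n}{n!}<\infty$ whenever $|m-m_o|<r$. *)

theory Defs
  imports "HOL-Analysis.Analysis" "HOL-Computational_Algebra.Polynomial"
begin

(* On the real line, a Borel measure that is finite on compact sets is automatically
   regular, so this is the usual notion of a positive Radon measure. *)
definition radon_measure :: "real measure \<Rightarrow> bool" where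
  "radon_measure \<nu> \<longleftrightarrow> sets \<nu> = sets borel \<and> (\<forall>K. compact K \<longrightarrow> emeasure \<nu> K < \<infinity>)"

definition laplace :: "real measure \<Rightarrow> real \<Rightarrow> ennreal" where
  "laplace \<nu> \<theta> = (\<integral>\<^sup>+ x. ennreal (exp (\<theta> * x)) \<partial>\<nu>)"

definition Theta :: "real measure \<Rightarrow> real set" where
  "Theta \<nu> = interior {\<theta>. laplace \<nu> \<theta> < \<infinity>}"

(* The last conjunct also excludes the zero measure. *)
definition MR :: "real measure set" where
  "MR = {\<nu>. radon_measure \<nu> \<and> Theta \<nu> \<noteq> {} \<and> \<not> (\<exists>a. AE x in \<nu>. x = a)}"

(* Meaningful for \<theta> in Theta \<nu> only, where the Laplace transform is finite and positive. *)
definition cumulant :: "real measure \<Rightarrow> real \<Rightarrow> real" where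
  "cumulant \<nu> \<theta> = ln (enn2real (laplace \<nu> \<theta>))"

definition tilt :: "real \<Rightarrow> real measure \<Rightarrow> real measure" where
  "tilt \<theta> \<nu> = density \<nu> (\<lambda>x. ennreal (exp (\<theta> * x - cumulant \<nu> \<theta>)))"

definition NEF_of :: "real measure \<Rightarrow> real measure set" where
  "NEF_of \<nu> = {tilt \<theta> \<nu> | \<theta>. \<theta> \<in> Theta \<nu>}"

definition is_NEF :: "real measure set \<Rightarrow> bool" where
  "is_NEF F \<longleftrightarrow> (\<exists>\<nu>\<in>MR. F = NEF_of \<nu>)"

(* The inverse of the derivative of the cumulant function, restricted to Theta \<nu>.  It is
   meaningful on the domain of the means, the image of Theta \<nu> under that derivative. *)
definition psi :: "real measure \<Rightarrow> real \<Rightarrow> real" where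
  "psi \<nu> = inv_into (Theta \<nu>) (deriv (cumulant \<nu>))"

definition mean_density :: "real measure \<Rightarrow> real \<Rightarrow> real \<Rightarrow> real" where
  "mean_density \<mu> x m = exp (psi \<mu> m * x - cumulant \<mu> (psi \<mu> m))"

(* For m0 in the domain of the means, which is open, the iterated derivative at m0 depends
   only on the values of the density at means m in that domain. *)
definition Pcoeff :: "real measure \<Rightarrow> real \<Rightarrow> nat \<Rightarrow> real \<Rightarrow> real" where
  "Pcoeff \<mu> m0 n x = (deriv ^^ n) (\<lambda>m. mean_density \<mu> x m) m0"

definition L2_space :: "real measure \<Rightarrow> (real \<Rightarrow> real) set" where
  "L2_space \<mu> = {g. g \<in> borel_measurable \<mu> \<and> integrable \<mu> (\<lambda>x. (g x)\<^sup>2)}"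

definition L2_norm :: "real measure \<Rightarrow> (real \<Rightarrow> real) \<Rightarrow> real" where
  "L2_norm \<mu> g = sqrt (\<integral>x. (g x)\<^sup>2 \<partial>\<mu>)"

end

theory Submission
  imports Defs "HOL-Complex_Analysis.Complex_Analysis"
begin

text \<open>
  The coefficients are derivatives of a holomorphic function, so Cauchy's inequality controls them
  pointwise in \<open>x\<close>; the only task is to make that control square integrable.

  Since \<open>0\<close> is interior to the domain of the Laplace transform of \<open>\<mu>\<close>, the transform extends to a
  holomorphic function on a vertical strip around the imaginary axis, with derivatives the
  exponential moments (\<open>moment_has_field_derivative\<close>). The complex mean
  \<open>L' / L\<close> is \<open>m0\<close> at \<open>0\<close>, and its derivative there is the variance of \<open>\<mu>\<close>, which is positive because
  \<open>\<mu>\<close> is not a point mass. Hence it has a local holomorphic inverse \<open>g\<close>, which agrees with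
  \<open>psi\<close> at real means near \<open>m0\<close> and whose values can be kept in an arbitrarily small disc around \<open>0\<close>
  (\<open>holomorphic_psi\<close>). So the density extends to
  \<open>f x w = exp (g w * x) / L (g w)\<close>, holomorphic in \<open>w\<close> on a ball around \<open>m0\<close> that does not depend
  on \<open>x\<close>.

  If \<open>\<bar>g w\<bar> < e\<close> and \<open>\<bar>L (g w)\<bar> > 1/2\<close> on this ball, then \<open>\<bar>f x w\<bar> \<le> 2 exp (e \<bar>x\<bar>)\<close>, and Cauchy's
  inequality on a circle of radius \<open>\<rho>\<close> bounds the \<open>n\<close>-th coefficient by
  \<open>n! \<cdot> 2 exp (e \<bar>x\<bar>) / \<rho>^n\<close>. For small \<open>e\<close> the function \<open>exp (2 e \<bar>x\<bar>)\<close> is \<open>\<mu>\<close>-integrable, so the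
  \<open>L\<^sup>2\<close> norms divided by \<open>n!\<close> are \<open>O (\<rho>^(-n))\<close>.

  That the coefficients are polynomials comes from the differential equation
  \<open>f' = f g' (x - w)\<close>: each differentiation raises the degree in \<open>x\<close> by one and multiplies the leading
  coefficient by \<open>g'\<close>, which does not vanish at \<open>m0\<close> (\<open>higher_deriv_polynomial_form\<close>).
\<close>

section \<open>Restricting holomorphic functions to the real axis\<close>

lemma has_real_derivative_Re_of_real:
  fixes F :: "complex \<Rightarrow> complex" and G :: "real \<Rightarrow> real"
  assumes F: "(F has_field_derivative D) (at (of_real t))"
    and A: "open A" "t \<in> A"
    and G: "\<And>s. s \<in> A \<Longrightarrow> G s = Re (F (of_real s))"
  shows "(G has_real_derivative Re D) (at t)"
proof -
  have "((\<lambda>s. F (of_real s)) has_vector_derivative D) (at t)"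
    using F by (rule has_vector_derivative_real_field)
  then have "((\<lambda>s. Re (F (of_real s))) has_vector_derivative Re D) (at t)"
    by (rule bounded_linear.has_vector_derivative[OF bounded_linear_Re])
  then have "((\<lambda>s. Re (F (of_real s))) has_real_derivative Re D) (at t)"
    by (simp add: has_real_derivative_iff_has_vector_derivative)
  then show ?thesis
    by (rule has_field_derivative_transform_within_open[OF _ A]) (simp add: G)
qed

text \<open>
  This moves iterated real derivatives, which appear in the definition of the coefficients, to the
  complex plane, where Cauchy's inequality is available.
\<close>

lemma higher_deriv_Re_of_real:
  fixes F :: "complex \<Rightarrow> complex" and G :: "real \<Rightarrow> real"
  assumes F: "F holomorphic_on S" "open S"
    and G: "\<And>s. of_real s \<in> S \<Longrightarrow> G s = Re (F (of_real s))"
    and t: "of_real t \<in> S"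
  shows "(deriv ^^ n) G t = Re ((deriv ^^ n) F (of_real t))"
  using t
proof (induction n arbitrary: t)
  case 0
  then show ?case by (simp add: G)
next
  case (Suc n)
  have A: "open {s. complex_of_real s \<in> S}"
    using open_vimage[OF F(2), of complex_of_real] by (simp add: vimage_def continuous_on_of_real_id)
  have "((deriv ^^ n) F has_field_derivative deriv ((deriv ^^ n) F) (of_real t)) (at (of_real t))"
    using holomorphic_derivI[OF holomorphic_higher_deriv[OF F, of n] F(2) Suc.prems] .
  then have "((deriv ^^ n) G has_real_derivative Re (deriv ((deriv ^^ n) F) (of_real t))) (at t)"
    by (rule has_real_derivative_Re_of_real[OF _ A]) (use Suc in auto)
  then show ?case by (simp add: DERIV_imp_deriv)
qed

section \<open>Exponential moments\<close>

text \<open>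
  The exponential series contains the term \<open>(d \<bar>x\<bar>)^n / n!\<close>.
\<close>

lemma abs_power_le_exp:
  fixes x d :: real
  assumes "d > 0"
  shows "\<bar>x\<bar> ^ n \<le> fact n / d ^ n * exp (d * \<bar>x\<bar>)"
proof -
  have "(\<lambda>k. (d * \<bar>x\<bar>) ^ k /\<^sub>R fact k) sums exp (d * \<bar>x\<bar>)"
    by (rule exp_converges)
  then have "sum (\<lambda>k. (d * \<bar>x\<bar>) ^ k /\<^sub>R fact k) {n} \<le> exp (d * \<bar>x\<bar>)"
    using assms by (intro order.trans[OF sum_le_suminf]) (auto simp: sums_iff)
  then have "(d * \<bar>x\<bar>) ^ n / fact n \<le> exp (d * \<bar>x\<bar>)"
    by (simp add: divide_inverse mult.commute)
  then show ?thesis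
    using assms by (simp add: field_simps power_mult_distrib)
qed

text \<open>
  Replaces an exponential of an absolute value by Laplace integrands at the two points
  \<open>t \<plusminus> d\<close>, whose integrability is what membership in \<open>Theta\<close> provides.
\<close>

lemma exp_abs_le_sum:
  fixes x u d :: real
  assumes "\<bar>u\<bar> \<le> d"
  shows "exp (\<bar>u * x\<bar> + t * x) \<le> exp ((t + d) * x) + exp ((t - d) * x)"
proof -
  have "\<bar>u * x\<bar> \<le> d * \<bar>x\<bar>"
    using assms by (simp add: abs_mult mult_right_mono)
  then have "\<bar>u * x\<bar> + t * x \<le> (t + d) * x \<or> \<bar>u * x\<bar> + t * x \<le> (t - d) * x"
    by (cases "x \<ge> 0") (auto simp: algebra_simps)
  then have "exp (\<bar>u * x\<bar> + t * x) \<le> exp ((t + d) * x) \<or> exp (\<bar>u * x\<bar> + t * x) \<le> exp ((t - d) * x)"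
    by simp
  then show ?thesis
    by (smt (verit) exp_ge_zero)
qed

lemma exp_of_real_mult: "exp (complex_of_real a * of_real b) = of_real (exp (a * b))"
  by (metis exp_of_real of_real_mult)

text \<open>
  The zero measure would be concentrated on every point.
\<close>

lemma not_AE_False_if_nondegenerate:
  assumes "\<not> (\<exists>a. AE x in M. x = a)"
  shows "\<not> (AE x in M. False)"
  using assms eventually_mono[of "\<lambda>x. False" "ae_filter M"] by blast

locale borel_real_measure =
  fixes \<mu> :: "real measure"
  assumes sets_eq [measurable_cong, simp]: "sets \<mu> = sets borel"
begin

lemma integrable_exp:
  assumes "\<theta> \<in> Theta \<mu>"
  shows "integrable \<mu> (\<lambda>x. exp (\<theta> * x))"
proof (rule integrableI_nonneg)
  show "(\<integral>\<^sup>+ x. ennreal (exp (\<theta> * x)) \<partial>\<mu>) < \<infinity>"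
    using assms interior_subset unfolding Theta_def laplace_def by blast
qed auto

lemma Theta_neighbourhood:
  assumes "\<theta> \<in> Theta \<mu>"
  obtains d where "d > 0" "\<And>t. \<bar>t - \<theta>\<bar> \<le> d \<Longrightarrow> t \<in> Theta \<mu>"
proof -
  have "open (Theta \<mu>)" by (simp add: Theta_def)
  then obtain d where "d > 0" "cball \<theta> d \<subseteq> Theta \<mu>"
    using assms open_contains_cball by blast
  then show thesis
    by (intro that[of d]) (auto simp: cball_def dist_real_def abs_minus_commute)
qed

text \<open>
  A power of \<open>x\<close> costs only an arbitrarily small shift of \<open>\<theta>\<close>, and \<open>Theta\<close> is open.
\<close>

lemma integrable_power_exp:
  assumes "\<theta> \<in> Theta \<mu>"
  shows "integrable \<mu> (\<lambda>x. \<bar>x\<bar> ^ n * exp (\<theta> * x))"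
proof -
  obtain d where d: "d > 0" "\<And>t. \<bar>t - \<theta>\<bar> \<le> d \<Longrightarrow> t \<in> Theta \<mu>"
    using Theta_neighbourhood[OF assms] by blast
  show ?thesis
  proof (rule Bochner_Integration.integrable_bound)
    show "integrable \<mu> (\<lambda>x. fact n / d ^ n * (exp ((\<theta> + d) * x) + exp ((\<theta> - d) * x)))"
      using d by (intro integrable_mult_right Bochner_Integration.integrable_add integrable_exp) auto
    show "AE x in \<mu>. norm (\<bar>x\<bar> ^ n * exp (\<theta> * x))
        \<le> norm (fact n / d ^ n * (exp ((\<theta> + d) * x) + exp ((\<theta> - d) * x)))"
    proof (rule AE_I2)
      fix x
      have "\<bar>x\<bar> ^ n * exp (\<theta> * x) \<le> fact n / d ^ n * exp (d * \<bar>x\<bar>) * exp (\<theta> * x)"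
        by (intro mult_right_mono abs_power_le_exp d) auto
      also have "\<dots> = fact n / d ^ n * exp (\<bar>d * x\<bar> + \<theta> * x)"
        using d by (simp add: exp_add abs_mult)
      also have "\<dots> \<le> fact n / d ^ n * (exp ((\<theta> + d) * x) + exp ((\<theta> - d) * x))"
        using d by (intro mult_left_mono exp_abs_le_sum) auto
      finally show "norm (\<bar>x\<bar> ^ n * exp (\<theta> * x))
          \<le> norm (fact n / d ^ n * (exp ((\<theta> + d) * x) + exp ((\<theta> - d) * x)))"
        using d(1) by (simp add: abs_mult power_abs)
    qed
  qed auto
qed

text \<open>
  The \<open>n\<close>-th derivative of the Laplace transform, for complex arguments; it is meaningful on the strip
  over \<open>Theta \<mu>\<close>.
\<close>

definition moment :: "nat \<Rightarrow> complex \<Rightarrow> complex" where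
  "moment n z = (\<integral>x. of_real x ^ n * exp (z * of_real x) \<partial>\<mu>)"

definition rmoment :: "nat \<Rightarrow> real \<Rightarrow> real" where
  "rmoment n \<theta> = (\<integral>x. x ^ n * exp (\<theta> * x) \<partial>\<mu>)"

lemma moment_of_real: "moment n (of_real \<theta>) = of_real (rmoment n \<theta>)"
proof -
  have "moment n (of_real \<theta>) = (\<integral>x. complex_of_real (x ^ n * exp (\<theta> * x)) \<partial>\<mu>)"
    unfolding moment_def by (intro Bochner_Integration.integral_cong) (auto simp: exp_of_real_mult)
  also have "\<dots> = of_real (rmoment n \<theta>)"
    unfolding rmoment_def by (rule integral_complex_of_real)
  finally show ?thesis .
qed

text \<open>
  This symmetry is what makes the holomorphic inverse of the mean real on the real axis.
\<close>

lemma moment_cnj: "moment n (cnj z) = cnj (moment n z)"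
proof -
  have "moment n (cnj z) = (\<integral>x. cnj (of_real x ^ n * exp (z * of_real x)) \<partial>\<mu>)"
    unfolding moment_def by (intro Bochner_Integration.integral_cong) (auto simp: exp_cnj)
  also have "\<dots> = cnj (moment n z)"
    unfolding moment_def by (rule Bochner_Integration.integral_cnj)
  finally show ?thesis .
qed

lemma integrable_moment:
  assumes "Re z \<in> Theta \<mu>"
  shows "integrable \<mu> (\<lambda>x. of_real x ^ n * exp (z * of_real x))"
proof (rule Bochner_Integration.integrable_bound[OF integrable_power_exp[OF assms, of n]])
  show "AE x in \<mu>. norm (complex_of_real x ^ n * exp (z * complex_of_real x))
      \<le> norm (\<bar>x\<bar> ^ n * exp (Re z * x))"
    by (simp add: norm_mult norm_power abs_mult)
qed measurable

text \<open>
  Differentiation under the integral: the remainder \<open>exp (h x) - 1 - h x\<close> is at most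
  \<open>\<bar>h x\<bar>\<^sup>2 exp \<bar>Re h x\<bar>\<close>, so the error of the difference quotient is \<open>\<bar>h\<bar>\<close> times an integral that stays
  bounded while \<open>Re z \<plusminus> \<bar>h\<bar>\<close> remains well inside \<open>Theta \<mu>\<close>.
\<close>

lemma moment_has_field_derivative:
  assumes z: "Re z \<in> Theta \<mu>"
  shows "(moment n has_field_derivative moment (Suc n) z) (at z)"
proof -
  obtain d where d: "d > 0" "\<And>t. \<bar>t - Re z\<bar> \<le> d \<Longrightarrow> t \<in> Theta \<mu>"
    using Theta_neighbourhood[OF z] by blast
  define W where "W x = \<bar>x\<bar> ^ (n + 2) * exp ((Re z + d) * x) + \<bar>x\<bar> ^ (n + 2) * exp ((Re z - d) * x)" for x
  have W: "integrable \<mu> W"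
    unfolding W_def using d by (intro Bochner_Integration.integrable_add integrable_power_exp) auto
  have bound: "norm ((moment n (z + h) - moment n z) / h - moment (Suc n) z) \<le> norm h * integral\<^sup>L \<mu> W"
    if h: "h \<noteq> 0" "norm h < d" for h
  proof -
    let ?E = "\<lambda>x. exp (h * of_real x) - (\<Sum>k\<le>1. (h * of_real x) ^ k / fact k)"
    have Re_h: "\<bar>Re h\<bar> \<le> d"
      using abs_Re_le_cmod[of h] h by linarith
    have zh: "Re (z + h) \<in> Theta \<mu>"
      using Re_h by (intro d) simp
    have int: "integrable \<mu> (\<lambda>x. of_real x ^ n * exp ((z + h) * of_real x))"
      "integrable \<mu> (\<lambda>x. of_real x ^ n * exp (z * of_real x))"
      "integrable \<mu> (\<lambda>x. h * (of_real x ^ Suc n * exp (z * of_real x)))"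
      using integrable_moment[OF zh] integrable_moment[OF z] integrable_mult_right by blast+
    have eq: "of_real x ^ n * exp ((z + h) * of_real x) - of_real x ^ n * exp (z * of_real x)
        - h * (of_real x ^ Suc n * exp (z * of_real x)) = of_real x ^ n * exp (z * of_real x) * ?E x" for x
      by (simp add: exp_add algebra_simps)
    have "moment n (z + h) - moment n z - h * moment (Suc n) z
        = (\<integral>x. of_real x ^ n * exp ((z + h) * of_real x) - of_real x ^ n * exp (z * of_real x)
        - h * (of_real x ^ Suc n * exp (z * of_real x)) \<partial>\<mu>)"
      using int by (simp add: moment_def del: power_Suc)
    also have "norm \<dots> \<le> (\<integral>x. (norm h)\<^sup>2 * W x \<partial>\<mu>)"
    proof (intro Bochner_Integration.integral_norm_bound_integral)
      fix x
      have "norm (?E x) \<le> exp \<bar>Re h * x\<bar> * norm (h * of_real x) ^ 2"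
        using Taylor_exp[of "h * of_real x" 1] by (simp add: numeral_2_eq_2)
      then have "norm (of_real x ^ n * exp (z * of_real x) * ?E x)
          \<le> \<bar>x\<bar> ^ n * exp (Re z * x) * (exp \<bar>Re h * x\<bar> * norm (h * of_real x) ^ 2)"
        unfolding norm_mult by (intro mult_mono) (auto simp: norm_power)
      also have "\<dots> = (norm h)\<^sup>2 * (\<bar>x\<bar> ^ (n + 2) * exp (\<bar>Re h * x\<bar> + Re z * x))"
        by (simp add: exp_add norm_mult power_mult_distrib power2_eq_square algebra_simps)
      also have "\<dots> \<le> (norm h)\<^sup>2 * (\<bar>x\<bar> ^ (n + 2) * (exp ((Re z + d) * x) + exp ((Re z - d) * x)))"
        by (intro mult_left_mono exp_abs_le_sum Re_h) auto
      finally show "norm (of_real x ^ n * exp ((z + h) * of_real x) - of_real x ^ n * exp (z * of_real x)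
        - h * (of_real x ^ Suc n * exp (z * of_real x))) \<le> (norm h)\<^sup>2 * W x"
        unfolding eq W_def by (simp only: distrib_left)
    qed (use int W in auto)
    finally have "norm (moment n (z + h) - moment n z - h * moment (Suc n) z) \<le> (norm h)\<^sup>2 * integral\<^sup>L \<mu> W"
      by simp
    then have "norm (moment n (z + h) - moment n z - h * moment (Suc n) z) / norm h \<le> norm h * integral\<^sup>L \<mu> W"
      using h by (simp add: divide_simps power2_eq_square mult_ac)
    moreover have "(moment n (z + h) - moment n z) / h - moment (Suc n) z
        = (moment n (z + h) - moment n z - h * moment (Suc n) z) / h"
      using h by (simp add: field_simps)
    ultimately show ?thesis by (simp add: norm_divide)
  qed
  have "((\<lambda>h. (moment n (z + h) - moment n z) / h - moment (Suc n) z) \<longlongrightarrow> 0) (at 0)"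
  proof (rule Lim_null_comparison)
    show "\<forall>\<^sub>F h in at 0. norm ((moment n (z + h) - moment n z) / h - moment (Suc n) z)
        \<le> norm h * integral\<^sup>L \<mu> W"
      using bound d(1) by (auto simp: eventually_at intro!: exI[of _ d])
    show "((\<lambda>h::complex. norm h * integral\<^sup>L \<mu> W) \<longlongrightarrow> 0) (at 0)"
      by (auto intro!: tendsto_eq_intros)
  qed
  then show ?thesis
    unfolding DERIV_def by (rule Lim_null[THEN iffD2])
qed

lemma rmoment_has_real_derivative:
  assumes "\<theta> \<in> Theta \<mu>"
  shows "(rmoment n has_real_derivative rmoment (Suc n) \<theta>) (at \<theta>)"
  using has_real_derivative_Re_of_real[OF moment_has_field_derivative, of \<theta> UNIV "rmoment n" n] assms
  by (simp add: moment_of_real)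

lemma cumulant_eq_ln_rmoment: "cumulant \<mu> \<theta> = ln (rmoment 0 \<theta>)"
  unfolding cumulant_def laplace_def rmoment_def
  by (subst integral_eq_nn_integral) auto

lemma integrable_power_real_exp:
  assumes "\<theta> \<in> Theta \<mu>"
  shows "integrable \<mu> (\<lambda>x. x ^ n * exp (\<theta> * x))"
  by (rule Bochner_Integration.integrable_bound[OF integrable_power_exp[OF assms, of n]])
    (auto simp: abs_mult power_abs)

text \<open>
  For \<open>t\<close> between \<open>a\<close> and \<open>b\<close>, \<open>exp (t x)\<close> is at most \<open>exp (a x)\<close> or at most \<open>exp (b x)\<close>, depending on the
  sign of \<open>x\<close>.
\<close>

lemma Theta_interval:
  assumes "a \<in> Theta \<mu>" "b \<in> Theta \<mu>" "a \<le> t" "t \<le> b"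
  shows "t \<in> Theta \<mu>"
proof -
  have "convex {\<theta>. laplace \<mu> \<theta> < \<infinity>}"
    unfolding is_interval_convex_1[symmetric] is_interval_1
  proof safe
    fix a b t :: real
    assume *: "laplace \<mu> a < \<infinity>" "laplace \<mu> b < \<infinity>" "a \<le> t" "t \<le> b"
    have "laplace \<mu> t \<le> (\<integral>\<^sup>+x. ennreal (exp (a * x)) + ennreal (exp (b * x)) \<partial>\<mu>)"
      unfolding laplace_def
    proof (rule nn_integral_mono)
      fix x
      have "t * x \<le> a * x \<or> t * x \<le> b * x"
        using *(3,4) by (cases "x \<ge> 0") (auto simp: mult_right_mono mult_right_mono_neg)
      then have "exp (t * x) \<le> exp (a * x) \<or> exp (t * x) \<le> exp (b * x)" by simp
      then have "exp (t * x) \<le> exp (a * x) + exp (b * x)"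
        by (smt (verit) exp_ge_zero)
      then show "ennreal (exp (t * x)) \<le> ennreal (exp (a * x)) + ennreal (exp (b * x))"
        by (simp flip: ennreal_plus)
    qed
    also have "\<dots> = laplace \<mu> a + laplace \<mu> b"
      unfolding laplace_def by (rule nn_integral_add) auto
    also have "\<dots> < \<infinity>" using * by simp
    finally show "laplace \<mu> t < \<infinity>" .
  qed
  then have "is_interval (Theta \<mu>)"
    unfolding Theta_def is_interval_convex_1 by (rule convex_interior)
  then show ?thesis
    using assms unfolding is_interval_1 by blast
qed

end

section \<open>The mean parametrisation\<close>

text \<open>
  These are the properties of the measure that remain once the generating measure of the family is
  forgotten; the member itself serves as the generator from here on.
\<close>

locale NEF_member = borel_real_measure +
  assumes zero_in_Theta: "0 \<in> Theta \<mu>"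
    and mass: "laplace \<mu> 0 = 1"
    and nondegenerate: "\<not> (\<exists>a. AE x in \<mu>. x = a)"
begin

lemma rmoment_0_pos:
  assumes "\<theta> \<in> Theta \<mu>"
  shows "rmoment 0 \<theta> > 0"
proof -
  have "rmoment 0 \<theta> \<noteq> 0"
    using integral_nonneg_eq_0_iff_AE[OF integrable_exp[OF assms]] not_AE_False_if_nondegenerate[OF nondegenerate]
    by (auto simp: rmoment_def)
  moreover have "rmoment 0 \<theta> \<ge> 0"
    by (simp add: rmoment_def)
  ultimately show ?thesis by simp
qed

text \<open>
  Up to positive factors this is the variance of the tilted measure, \<open>\<integral> (x - c)\<^sup>2 exp (\<theta> x) d\<mu>\<close> with
  \<open>c\<close> its mean; it can vanish only if \<open>\<mu>\<close> is concentrated on \<open>c\<close>.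
\<close>

lemma rmoment_variance_pos:
  assumes "\<theta> \<in> Theta \<mu>"
  shows "rmoment 2 \<theta> * rmoment 0 \<theta> - (rmoment 1 \<theta>)\<^sup>2 > 0"
proof -
  define c where "c = rmoment 1 \<theta> / rmoment 0 \<theta>"
  note p = rmoment_0_pos[OF assms]
  note int = integrable_power_real_exp[OF assms]
  have eq: "(x - c)\<^sup>2 * exp (\<theta> * x)
      = x ^ 2 * exp (\<theta> * x) - 2 * c * (x ^ 1 * exp (\<theta> * x)) + c\<^sup>2 * (x ^ 0 * exp (\<theta> * x))" for x
    by (simp add: power2_eq_square algebra_simps)
  have I: "integrable \<mu> (\<lambda>x. (x - c)\<^sup>2 * exp (\<theta> * x))"
    unfolding eq by (intro Bochner_Integration.integrable_add Bochner_Integration.integrable_diff integrable_mult_right int)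
  have "(\<integral>x. (x - c)\<^sup>2 * exp (\<theta> * x) \<partial>\<mu>) = rmoment 2 \<theta> - 2 * c * rmoment 1 \<theta> + c\<^sup>2 * rmoment 0 \<theta>"
    unfolding eq rmoment_def
    using int[of 0] int[of 1] int[of 2]
    by (simp only: Bochner_Integration.integral_add Bochner_Integration.integral_diff
        Bochner_Integration.integrable_diff integrable_mult_right integral_mult_right_zero)
  also have "\<dots> = (rmoment 2 \<theta> * rmoment 0 \<theta> - (rmoment 1 \<theta>)\<^sup>2) / rmoment 0 \<theta>"
    using p by (simp add: c_def field_simps power2_eq_square)
  finally have V: "(\<integral>x. (x - c)\<^sup>2 * exp (\<theta> * x) \<partial>\<mu>)
      = (rmoment 2 \<theta> * rmoment 0 \<theta> - (rmoment 1 \<theta>)\<^sup>2) / rmoment 0 \<theta>" .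
  have "(\<integral>x. (x - c)\<^sup>2 * exp (\<theta> * x) \<partial>\<mu>) \<noteq> 0"
    using integral_nonneg_eq_0_iff_AE[OF I] nondegenerate by auto
  moreover have "(\<integral>x. (x - c)\<^sup>2 * exp (\<theta> * x) \<partial>\<mu>) \<ge> 0"
    by simp
  ultimately have "(\<integral>x. (x - c)\<^sup>2 * exp (\<theta> * x) \<partial>\<mu>) > 0"
    by linarith
  then have "(rmoment 2 \<theta> * rmoment 0 \<theta> - (rmoment 1 \<theta>)\<^sup>2) / rmoment 0 \<theta> > 0"
    unfolding V .
  then show ?thesis
    using p by (simp add: zero_less_divide_iff)
qed

lemma deriv_cumulant:
  assumes "\<theta> \<in> Theta \<mu>"
  shows "deriv (cumulant \<mu>) \<theta> = rmoment 1 \<theta> / rmoment 0 \<theta>"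
proof (rule DERIV_imp_deriv)
  have "((\<lambda>t. ln (rmoment 0 t)) has_real_derivative rmoment 1 \<theta> / rmoment 0 \<theta>) (at \<theta>)"
    using rmoment_has_real_derivative[OF assms, of 0] rmoment_0_pos[OF assms]
    by (auto intro!: derivative_eq_intros simp: field_simps)
  then show "(cumulant \<mu> has_real_derivative rmoment 1 \<theta> / rmoment 0 \<theta>) (at \<theta>)"
    by (simp add: cumulant_eq_ln_rmoment[abs_def])
qed

text \<open>
  The derivative of the mean is the variance. Injectivity on the whole of \<open>Theta \<mu>\<close>, rather than only near
  \<open>0\<close>, is what identifies the globally defined \<open>psi\<close> with a local inverse.
\<close>

lemma inj_on_deriv_cumulant: "inj_on (deriv (cumulant \<mu>)) (Theta \<mu>)"
proof (rule linorder_inj_onI')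
  fix a b
  assume ab: "a \<in> Theta \<mu>" "b \<in> Theta \<mu>" "a < b"
  have "rmoment 1 a / rmoment 0 a < rmoment 1 b / rmoment 0 b"
  proof (rule DERIV_pos_imp_increasing[OF \<open>a < b\<close>])
    fix t
    assume "a \<le> t" "t \<le> b"
    then have t: "t \<in> Theta \<mu>" using Theta_interval ab by blast
    have "((\<lambda>t. rmoment 1 t / rmoment 0 t) has_real_derivative
        (rmoment 2 t * rmoment 0 t - rmoment 1 t * rmoment 1 t) / (rmoment 0 t * rmoment 0 t)) (at t)"
      using DERIV_divide[OF rmoment_has_real_derivative[OF t, of 1] rmoment_has_real_derivative[OF t, of 0]]
        rmoment_0_pos[OF t] by (simp add: numeral_2_eq_2)
    moreover have "(rmoment 2 t * rmoment 0 t - rmoment 1 t * rmoment 1 t) / (rmoment 0 t * rmoment 0 t) > 0"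
      using rmoment_variance_pos[OF t] rmoment_0_pos[OF t] by (simp add: power2_eq_square)
    ultimately show "\<exists>y. ((\<lambda>t. rmoment 1 t / rmoment 0 t) has_real_derivative y) (at t) \<and> y > 0"
      by blast
  qed
  then show "deriv (cumulant \<mu>) a \<noteq> deriv (cumulant \<mu>) b"
    using ab by (simp add: deriv_cumulant)
qed

lemma rmoment_0_0: "rmoment 0 0 = 1"
  using mass unfolding laplace_def rmoment_def
  by (subst integral_eq_nn_integral) auto

text \<open>
  The derivative of the cumulant function for complex arguments. Defining it as a quotient, and not
  through a complex logarithm, avoids the choice of a branch.
\<close>

definition cmean :: "complex \<Rightarrow> complex" where
  "cmean z = moment 1 z / moment 0 z"

lemma cmean_has_field_derivative:
  assumes "Re z \<in> Theta \<mu>" "moment 0 z \<noteq> 0"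
  shows "(cmean has_field_derivative
      (moment 2 z * moment 0 z - (moment 1 z)\<^sup>2) / (moment 0 z)\<^sup>2) (at z)"
  using DERIV_divide[OF moment_has_field_derivative[OF assms(1), of 1]
      moment_has_field_derivative[OF assms(1), of 0] assms(2)]
  by (simp add: cmean_def[abs_def] numeral_2_eq_2)

end

text \<open>
  The inverse function theorem applies to the complex mean at \<open>0\<close>, where its derivative is the variance.
  At a real mean \<open>m\<close> the value \<open>g m\<close> and its conjugate have the same complex mean, so they coincide by
  injectivity on a disc; being real, \<open>g m\<close> must then be \<open>psi \<mu> m\<close>. The parameter \<open>e\<close> lets the caller choose
  how much exponential growth in \<open>x\<close> the extended density may have.
\<close>

lemma (in NEF_member) holomorphic_psi:
  fixes m0 :: real
  assumes e: "e > 0" and m0: "m0 = (\<integral>x. x \<partial>\<mu>)"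
  obtains R g where "R > 0" "g holomorphic_on ball (of_real m0) R"
    "g (of_real m0) = 0" "\<exists>a::real. a \<noteq> 0 \<and> deriv g (of_real m0) = of_real a"
    "\<And>w. w \<in> ball (of_real m0) R \<Longrightarrow> cmod (g w) < e \<and> cmod (moment 0 (g w)) > 1 / 2
       \<and> Re (g w) \<in> Theta \<mu> \<and> moment 1 (g w) = w * moment 0 (g w)"
    "\<And>m::real. of_real m \<in> ball (of_real m0 :: complex) R \<Longrightarrow> g (of_real m) = of_real (psi \<mu> m)"
proof -
  obtain d where d: "d > 0" "\<And>t. \<bar>t - 0\<bar> \<le> d \<Longrightarrow> t \<in> Theta \<mu>"
    using Theta_neighbourhood[OF zero_in_Theta] by blast
  have cont: "isCont (moment 0) 0"
    using moment_has_field_derivative[of 0 0] zero_in_Theta DERIV_isCont by simp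
  have mom0: "moment 0 0 = 1"
    using moment_of_real[of 0 0] by (simp add: rmoment_0_0)
  obtain s where s: "s > 0" "\<And>z. cmod z < s \<Longrightarrow> dist (moment 0 z) 1 < 1 / 2"
    using cont[unfolded continuous_at_eps_delta, rule_format, of "1/2"] mom0 by auto
  (* On this disc the transform cannot vanish, so the complex mean is holomorphic there. *)
  define q where "q = min e (min d s)"
  have q: "q > 0" using e d(1) s(1) by (simp add: q_def)
  have Qe: "cmod z < e" "Re z \<in> Theta \<mu>" "cmod (moment 0 z) > 1 / 2" if "z \<in> ball 0 q" for z
  proof -
    have z: "cmod z < e" "cmod z < d" "cmod z < s" using that by (auto simp: q_def)
    show "cmod z < e" by fact
    show "Re z \<in> Theta \<mu>"
      using abs_Re_le_cmod[of z] z by (intro d) auto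
    show "cmod (moment 0 z) > 1 / 2"
      using s(2)[OF z(3)] norm_triangle_ineq2[of 1 "moment 0 z"]
      by (simp add: dist_norm norm_minus_commute)
  qed
  have ne: "moment 0 z \<noteq> 0" if "z \<in> ball 0 q" for z
    using Qe(3)[OF that] by auto
  have der: "(cmean has_field_derivative
      (moment 2 z * moment 0 z - (moment 1 z)\<^sup>2) / (moment 0 z)\<^sup>2) (at z)" if "z \<in> ball 0 q" for z
    using cmean_has_field_derivative Qe(2) ne that by blast
  have hol: "cmean holomorphic_on ball 0 q"
    using der holomorphic_on_open open_ball by blast
  define v where "v = rmoment 2 0 - (rmoment 1 0)\<^sup>2"
  have v: "v > 0"
    using rmoment_variance_pos[OF zero_in_Theta] by (simp add: v_def rmoment_0_0)
  have der0: "deriv cmean 0 = of_real v"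
  proof -
    have "deriv cmean 0 = (moment 2 0 * moment 0 0 - (moment 1 0)\<^sup>2) / (moment 0 0)\<^sup>2"
      using q by (intro DERIV_imp_deriv der) simp
    also have "\<dots> = of_real v"
      using moment_of_real[of 2 0] moment_of_real[of 1 0] by (simp add: v_def mom0)
    finally show ?thesis .
  qed
  have m0': "cmean 0 = of_real m0"
    using moment_of_real[of 1 0] mom0 by (simp add: cmean_def m0 rmoment_def)
  obtain r where r: "r > 0" "ball (0::complex) r \<subseteq> ball 0 q" "open (cmean ` ball 0 r)" "inj_on cmean (ball 0 r)"
  proof (rule has_complex_derivative_locally_invertible[OF hol _ open_ball])
    show "0 \<in> ball (0::complex) q" using q by simp
    show "deriv cmean 0 \<noteq> 0" using der0 v by simp
  qed (rule that)
  have hol': "cmean holomorphic_on ball 0 r"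
    using hol r(2) holomorphic_on_subset by blast
  obtain g where g: "g holomorphic_on (cmean ` ball 0 r)"
      "\<And>z. z \<in> ball 0 r \<Longrightarrow> deriv cmean z * deriv g (cmean z) = 1"
      "\<And>z. z \<in> ball 0 r \<Longrightarrow> g (cmean z) = z"
    using holomorphic_has_inverse[OF hol' open_ball r(4)] by blast
  have "of_real m0 \<in> cmean ` ball 0 r"
    using m0' r(1) by (intro image_eqI[of _ _ 0]) auto
  then obtain R where R: "R > 0" "ball (of_real m0) R \<subseteq> cmean ` ball 0 r"
    using r(3) open_contains_ball by blast
  have gw: "g w \<in> ball 0 r" "cmean (g w) = w" if w: "w \<in> ball (of_real m0) R" for w
    using w R(2) g(3) by force+
  show thesis
  proof (rule that[of R g])
    show "R > 0" by fact
    show "g holomorphic_on ball (of_real m0) R"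
      using g(1) R(2) holomorphic_on_subset by blast
    show "g (of_real m0) = 0"
      using g(3)[of 0] r(1) m0' by simp
    show "\<exists>a::real. a \<noteq> 0 \<and> deriv g (of_real m0) = of_real a"
      using g(2)[of 0] r(1) m0' v der0 by (intro exI[of _ "1 / v"]) (auto simp: field_simps)
    show "cmod (g w) < e \<and> cmod (moment 0 (g w)) > 1 / 2
       \<and> Re (g w) \<in> Theta \<mu> \<and> moment 1 (g w) = w * moment 0 (g w)" if w: "w \<in> ball (of_real m0) R" for w
    proof -
      have "g w \<in> ball 0 q" using gw(1)[OF w] r(2) by blast
      then show ?thesis
        using Qe[of "g w"] ne[of "g w"] gw(2)[OF w] by (simp add: cmean_def field_simps)
    qed
    show "g (of_real m) = of_real (psi \<mu> m)" if m: "of_real m \<in> ball (of_real m0 :: complex) R" for m :: real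
    proof -
      let ?z = "g (of_real m)"
      have "cmean (cnj ?z) = cnj (cmean ?z)"
        by (simp add: cmean_def moment_cnj)
      also have "\<dots> = cmean ?z"
        using gw(2)[OF m] by simp
      finally have "cnj ?z = ?z"
        using inj_onD[OF r(4)] gw(1)[OF m] by simp
      then have real: "?z = of_real (Re ?z)"
        by (simp add: complex_eq_iff)
      have Th: "Re ?z \<in> Theta \<mu>"
        using gw(1)[OF m] r(2) Qe(2) by blast
      have "complex_of_real (rmoment 1 (Re ?z) / rmoment 0 (Re ?z)) = cmean (of_real (Re ?z))"
        by (simp add: cmean_def moment_of_real)
      also have "\<dots> = of_real m"
        using gw(2)[OF m] real by simp
      finally have "deriv (cumulant \<mu>) (Re ?z) = m"
        using deriv_cumulant[OF Th] by (simp only: of_real_eq_iff)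
      then have "psi \<mu> m = Re ?z"
        unfolding psi_def using inv_into_f_eq[OF inj_on_deriv_cumulant Th] by blast
      then show ?thesis using real by simp
    qed
  qed
qed

section \<open>The coefficients as polynomials and their norms\<close>

text \<open>
  Differentiating \<open>f x w * p w x\<close> gives \<open>f x w\<close> times \<open>p' w x + h w (x - w) p w x\<close>, where \<open>p'\<close> is the
  derivative in \<open>w\<close>. Only the factor \<open>h w x\<close> raises the degree, so the leading coefficient is
  multiplied by \<open>h w\<close>. The coefficients are kept holomorphic so that they can be differentiated again.
\<close>

lemma higher_deriv_polynomial_form:
  fixes f :: "complex \<Rightarrow> complex \<Rightarrow> complex"
  assumes S: "open S" and h: "h holomorphic_on S"
    and f: "\<And>x w. w \<in> S \<Longrightarrow> (f x has_field_derivative f x w * h w * (x - w)) (at w)"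
  shows "\<exists>c. (\<forall>j. c j holomorphic_on S) \<and> c n = (\<lambda>w. h w ^ n) \<and>
      (\<forall>x. \<forall>w\<in>S. (deriv ^^ n) (f x) w = f x w * (\<Sum>j\<le>n. c j w * x ^ j))"
proof (induction n)
  case 0
  show ?case by (intro exI[of _ "\<lambda>j w. 1"]) auto
next
  case (Suc n)
  then obtain c where c: "\<And>j. c j holomorphic_on S" "c n = (\<lambda>w. h w ^ n)"
    "\<And>x w. w \<in> S \<Longrightarrow> (deriv ^^ n) (f x) w = f x w * (\<Sum>j\<le>n. c j w * x ^ j)"
    by blast
  (* The new coefficients; the lower ones collect the terms of equal degree in x. *)
  define b where "b j w = (if j = Suc n then h w ^ Suc n else
      deriv (c j) w - w * h w * c j w + (if j = 0 then 0 else h w * c (j - 1) w))" for j w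
  have "b j holomorphic_on S" for j
  proof -
    have "(\<lambda>w. deriv (c j) w - w * h w * c j w + (if j = 0 then 0 else h w * c (j - 1) w)) holomorphic_on S"
      by (cases j) (auto intro!: holomorphic_intros holomorphic_deriv c h S)
    then show ?thesis
      unfolding b_def[abs_def] by (cases "j = Suc n") (auto intro!: holomorphic_intros h simp del: power_Suc)
  qed
  moreover have "b (Suc n) = (\<lambda>w. h w ^ Suc n)"
    by (simp add: b_def[abs_def])
  moreover have "(deriv ^^ Suc n) (f x) w = f x w * (\<Sum>j\<le>Suc n. b j w * x ^ j)" if w: "w \<in> S" for x w
  proof -
    let ?p = "\<lambda>w. \<Sum>j\<le>n. c j w * x ^ j"
    have dc: "(c j has_field_derivative deriv (c j) w) (at w)" for j
      using holomorphic_derivI[OF c(1) S w] .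
    have "((\<lambda>w. f x w * ?p w) has_field_derivative
        f x w * h w * (x - w) * ?p w + (\<Sum>j\<le>n. deriv (c j) w * x ^ j) * f x w) (at w)"
      by (intro DERIV_mult f w DERIV_sum DERIV_cmult_right dc)
    then have "((deriv ^^ n) (f x) has_field_derivative
        f x w * h w * (x - w) * ?p w + (\<Sum>j\<le>n. deriv (c j) w * x ^ j) * f x w) (at w)"
      by (rule has_field_derivative_transform_within_open[OF _ S w]) (simp add: c(3))
    then have "(deriv ^^ Suc n) (f x) w
        = f x w * (h w * x * ?p w - w * h w * ?p w + (\<Sum>j\<le>n. deriv (c j) w * x ^ j))"
      by (simp add: DERIV_imp_deriv algebra_simps)
    also have "h w * x * ?p w = (\<Sum>j\<in>{1..Suc n}. h w * c (j - 1) w * x ^ j)"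
      by (simp add: sum.atLeast1_atMost_eq lessThan_Suc_atMost sum_distrib_left mult_ac
          del: sum.cl_ivl_Suc)
    also have "\<dots> = h w ^ Suc n * x ^ Suc n + (\<Sum>j\<in>{1..n}. h w * c (j - 1) w * x ^ j)"
      by (simp add: c(2))
    also have "(\<Sum>j\<in>{1..n}. h w * c (j - 1) w * x ^ j)
        = (\<Sum>j\<le>n. (if j = 0 then 0 else h w * c (j - 1) w) * x ^ j)"
      by (rule sum.mono_neutral_cong_left) auto
    also have "h w ^ Suc n * x ^ Suc n + (\<Sum>j\<le>n. (if j = 0 then 0 else h w * c (j - 1) w) * x ^ j)
          - w * h w * ?p w + (\<Sum>j\<le>n. deriv (c j) w * x ^ j)
        = h w ^ Suc n * x ^ Suc n + (\<Sum>j\<le>n. b j w * x ^ j)"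
      by (simp add: b_def sum_distrib_left sum.distrib sum_subtractf algebra_simps del: power_Suc)
    also have "\<dots> = (\<Sum>j\<le>Suc n. b j w * x ^ j)"
      by (simp add: b_def)
    finally show ?thesis .
  qed
  ultimately show ?case by blast
qed

text \<open>
  The three claims share the holomorphic extension \<open>f\<close> of the density, normalised so that it is
  \<open>1\<close> at \<open>m0\<close>.
\<close>

lemma (in NEF_member) Pcoeff_properties:
  assumes m0: "m0 = (\<integral>x. x \<partial>\<mu>)"
  shows "\<exists>p :: real poly. degree p = n \<and> (\<forall>x. Pcoeff \<mu> m0 n x = poly p x)" (is ?polynomial)
    and "Pcoeff \<mu> m0 n \<in> L2_space \<mu>" (is ?L2)
    and "\<exists>r>0. \<forall>m. \<bar>m - m0\<bar> < r \<longrightarrow>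
            summable (\<lambda>n. L2_norm \<mu> (Pcoeff \<mu> m0 n) * \<bar>m - m0\<bar> ^ n / fact n)" (is ?radius)
proof -
  obtain d where d: "d > 0" "\<And>t. \<bar>t - 0\<bar> \<le> d \<Longrightarrow> t \<in> Theta \<mu>"
    using Theta_neighbourhood[OF zero_in_Theta] by blast
  (* The square of exp (e |x|) is dominated by exp (d x) + exp (- d x), which is integrable. *)
  define e where "e = d / 2"
  have "e > 0" using d by (simp add: e_def)
  obtain R g where R: "R > 0" and g: "g holomorphic_on ball (of_real m0) R"
    "g (of_real m0) = 0" "\<exists>a::real. a \<noteq> 0 \<and> deriv g (of_real m0) = of_real a"
    "\<And>w. w \<in> ball (of_real m0) R \<Longrightarrow> cmod (g w) < e \<and> cmod (moment 0 (g w)) > 1 / 2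
       \<and> Re (g w) \<in> Theta \<mu> \<and> moment 1 (g w) = w * moment 0 (g w)"
    "\<And>m::real. of_real m \<in> ball (of_real m0 :: complex) R \<Longrightarrow> g (of_real m) = of_real (psi \<mu> m)"
    using holomorphic_psi[OF \<open>e > 0\<close> m0] by blast
  let ?B = "ball (complex_of_real m0) R"
  define f where "f x w = exp (g w * x) / moment 0 (g w)" for x w
  have f_deriv: "(f x has_field_derivative f x w * deriv g w * (x - w)) (at w)" if w: "w \<in> ?B" for x w
  proof -
    have gd: "(g has_field_derivative deriv g w) (at w)"
      using holomorphic_derivI[OF g(1) open_ball w] .
    have nz: "moment 0 (g w) \<noteq> 0"
      using g(4)[OF w] by auto
    have md: "((\<lambda>w. moment 0 (g w)) has_field_derivative moment 1 (g w) * deriv g w) (at w)"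
      using DERIV_chain2[OF moment_has_field_derivative gd, of 0] g(4)[OF w] by simp
    have "(f x has_field_derivative (exp (g w * x) * (deriv g w * x) * moment 0 (g w)
        - exp (g w * x) * (moment 1 (g w) * deriv g w)) / (moment 0 (g w) * moment 0 (g w))) (at w)"
      unfolding f_def[abs_def]
      by (intro DERIV_divide DERIV_fun_exp DERIV_cmult_right gd md nz)
    moreover have "(exp (g w * x) * (deriv g w * x) * moment 0 (g w)
        - exp (g w * x) * (moment 1 (g w) * deriv g w)) / (moment 0 (g w) * moment 0 (g w))
        = f x w * deriv g w * (x - w)"
      using nz g(4)[OF w] by (simp add: f_def field_simps)
    ultimately show ?thesis by simp
  qed
  have f_hol: "f x holomorphic_on ?B" for x
    using f_deriv holomorphic_on_open open_ball by blast
  have f_real: "mean_density \<mu> x m = Re (f (of_real x) (of_real m))" if m: "of_real m \<in> ?B" for x m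
  proof -
    have Th: "psi \<mu> m \<in> Theta \<mu>"
      using g(4)[OF m] g(5)[OF m] by simp
    have "f (of_real x) (of_real m) = of_real (exp (psi \<mu> m * x) / rmoment 0 (psi \<mu> m))"
      unfolding f_def g(5)[OF m] moment_of_real by (simp add: exp_of_real_mult)
    moreover have "mean_density \<mu> x m = exp (psi \<mu> m * x) / rmoment 0 (psi \<mu> m)"
      using rmoment_0_pos[OF Th] by (simp add: mean_density_def cumulant_eq_ln_rmoment exp_diff)
    ultimately show ?thesis by simp
  qed
  have P: "Pcoeff \<mu> m0 n x = Re ((deriv ^^ n) (f (of_real x)) (of_real m0))" for n x
    unfolding Pcoeff_def
    by (rule higher_deriv_Re_of_real[OF f_hol open_ball]) (use f_real R in auto)
  have poly: "\<exists>p :: real poly. degree p = n \<and> (\<forall>x. Pcoeff \<mu> m0 n x = poly p x)" for n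
  proof -
    obtain c where c: "c n = (\<lambda>w. deriv g w ^ n)"
      "\<And>x w. w \<in> ?B \<Longrightarrow> (deriv ^^ n) (f x) w = f x w * (\<Sum>j\<le>n. c j w * x ^ j)"
      using higher_deriv_polynomial_form[OF open_ball holomorphic_deriv[OF g(1) open_ball] f_deriv, of n] by blast
    have f1: "f x (of_real m0) = 1" for x
      using g(2) moment_of_real[of 0 0] by (simp add: f_def rmoment_0_0)
    define p where "p = (\<Sum>j\<le>n. monom (Re (c j (of_real m0))) j)"
    have "Pcoeff \<mu> m0 n x = poly p x" for x
    proof -
      have "Pcoeff \<mu> m0 n x = Re (\<Sum>j\<le>n. c j (of_real m0) * of_real (x ^ j))"
        unfolding P using c(2)[of "of_real m0" "of_real x"] R f1 by simp
      then show ?thesis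
        by (simp add: p_def poly_sum poly_monom del: of_real_power)
    qed
    moreover have "degree p = n"
    proof (rule antisym)
      show "degree p \<le> n"
        unfolding p_def by (intro degree_sum_le) (auto intro: order.trans[OF degree_monom_le])
      have "coeff p n = Re (c n (of_real m0))"
        by (simp add: p_def coeff_sum)
      also have "\<dots> \<noteq> 0"
        using g(3) c(1) by (auto simp flip: of_real_power)
      finally show "n \<le> degree p" by (rule le_degree)
    qed
    ultimately show ?thesis by blast
  qed
  then show ?polynomial .
  define \<rho> where "\<rho> = R / 2"
  have \<rho>: "\<rho> > 0" "\<rho> < R" using R by (auto simp: \<rho>_def)
  have bound: "\<bar>Pcoeff \<mu> m0 n x\<bar> \<le> fact n * (2 * exp (e * \<bar>x\<bar>)) / \<rho> ^ n" for n x
  proof -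
    have "cmod ((deriv ^^ n) (f (of_real x)) (of_real m0)) \<le> fact n * (2 * exp (e * \<bar>x\<bar>)) / \<rho> ^ n"
    proof (rule Cauchy_inequality)
      show "f (of_real x) holomorphic_on ball (of_real m0) \<rho>"
        by (rule holomorphic_on_subset[OF f_hol]) (use \<rho> in auto)
      show "continuous_on (cball (of_real m0) \<rho>) (f (of_real x))"
        by (rule holomorphic_on_imp_continuous_on[OF holomorphic_on_subset[OF f_hol]]) (use \<rho> in auto)
      show "\<rho> > 0" by fact
      fix w assume "cmod (of_real m0 - w) = \<rho>"
      then have w: "w \<in> ?B" using \<rho> by (simp add: dist_norm)
      have "Re (g w) * x \<le> cmod (g w) * \<bar>x\<bar>"
        using abs_Re_le_cmod[of "g w"] by (metis abs_ge_self abs_ge_zero abs_mult mult_right_mono order.trans)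
      also have "\<dots> \<le> e * \<bar>x\<bar>"
        using g(4)[OF w] by (intro mult_right_mono) auto
      finally have "cmod (exp (g w * of_real x)) \<le> exp (e * \<bar>x\<bar>)" by simp
      (* The factor 2 comes from the lower bound 1 / 2 of the transform. *)
      then have "cmod (f (of_real x) w) \<le> exp (e * \<bar>x\<bar>) / (1 / 2)"
        unfolding f_def norm_divide using g(4)[OF w] by (intro frac_le) auto
      then show "cmod (f (of_real x) w) \<le> 2 * exp (e * \<bar>x\<bar>)" by simp
    qed
    then show ?thesis
      unfolding P using abs_Re_le_cmod order.trans by blast
  qed
  define I where "I x = exp (d * x) + exp (- d * x)" for x
  have I: "integrable \<mu> I"
    unfolding I_def using d by (intro Bochner_Integration.integrable_add integrable_exp) auto
  have sq: "(Pcoeff \<mu> m0 n x)\<^sup>2 \<le> (2 * fact n / \<rho> ^ n)\<^sup>2 * I x" for n x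
  proof -
    have "(Pcoeff \<mu> m0 n x)\<^sup>2 \<le> (fact n * (2 * exp (e * \<bar>x\<bar>)) / \<rho> ^ n)\<^sup>2"
      using bound power_mono[OF bound abs_ge_zero, where n=2] by simp
    also have "\<dots> = (2 * fact n / \<rho> ^ n)\<^sup>2 * exp (\<bar>d * x\<bar> + 0 * x)"
      using d(1) by (simp add: e_def power_mult_distrib power_divide abs_mult flip: exp_double)
    also have "\<dots> \<le> (2 * fact n / \<rho> ^ n)\<^sup>2 * I x"
      unfolding I_def using exp_abs_le_sum[of d d x 0] d(1) by (intro mult_left_mono) auto
    finally show ?thesis .
  qed
  have meas: "Pcoeff \<mu> m0 n \<in> borel_measurable \<mu>" for n
  proof -
    obtain p :: "real poly" where "Pcoeff \<mu> m0 n = poly p"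
      using poly by blast
    then show ?thesis 
      by (simp add: measurable_cong_sets[OF sets_eq refl] borel_measurable_continuous_onI
          continuous_on_poly[OF continuous_on_id])
  qed
  have int: "integrable \<mu> (\<lambda>x. (Pcoeff \<mu> m0 n x)\<^sup>2)" for n
    by (rule Bochner_Integration.integrable_bound[OF integrable_mult_right[OF I, of "(2 * fact n / \<rho> ^ n)\<^sup>2"]])
      (use meas sq in \<open>auto intro!: AE_I2 order.trans[OF sq abs_ge_self]\<close>)
  then show ?L2 using meas by (simp add: L2_space_def)
  define K where "K = 2 * sqrt (integral\<^sup>L \<mu> I)"
  have norm: "L2_norm \<mu> (Pcoeff \<mu> m0 n) \<le> fact n * K / \<rho> ^ n" for n
  proof -
    have "(\<integral>x. (Pcoeff \<mu> m0 n x)\<^sup>2 \<partial>\<mu>) \<le> (\<integral>x. (2 * fact n / \<rho> ^ n)\<^sup>2 * I x \<partial>\<mu>)"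
      by (intro integral_mono int integrable_mult_right I sq)
    then have "L2_norm \<mu> (Pcoeff \<mu> m0 n) \<le> sqrt ((2 * fact n / \<rho> ^ n)\<^sup>2 * integral\<^sup>L \<mu> I)"
      by (simp add: L2_norm_def)
    also have "\<dots> = fact n * K / \<rho> ^ n"
      using \<rho> by (simp add: real_sqrt_mult K_def)
    finally show ?thesis .
  qed
  show ?radius
  proof (intro exI[of _ \<rho>] conjI allI impI)
    show "\<rho> > 0" by fact
    fix m assume m: "\<bar>m - m0\<bar> < \<rho>"
    show "summable (\<lambda>n. L2_norm \<mu> (Pcoeff \<mu> m0 n) * \<bar>m - m0\<bar> ^ n / fact n)"
    proof (rule summable_comparison_test')
      show "summable (\<lambda>n. K * (\<bar>m - m0\<bar> / \<rho>) ^ n)"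
        using m \<rho> by (intro summable_mult summable_geometric) simp
      fix n :: nat
      have "L2_norm \<mu> (Pcoeff \<mu> m0 n) * \<bar>m - m0\<bar> ^ n / fact n
          \<le> fact n * K / \<rho> ^ n * \<bar>m - m0\<bar> ^ n / fact n"
        by (intro divide_right_mono mult_right_mono norm) auto
      also have "\<dots> = K * (\<bar>m - m0\<bar> / \<rho>) ^ n"
        by (simp add: power_divide)
      finally show "norm (L2_norm \<mu> (Pcoeff \<mu> m0 n) * \<bar>m - m0\<bar> ^ n / fact n)
          \<le> K * (\<bar>m - m0\<bar> / \<rho>) ^ n"
        by (simp add: L2_norm_def abs_mult)
    qed
  qed
qed

section \<open>Members of a natural exponential family\<close>

text \<open>
  Tilting by \<open>\<theta>\<close> shifts the Laplace transform by \<open>\<theta>\<close> and rescales it to the value \<open>1\<close> at \<open>0\<close>; its positive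
  density preserves the null sets.
\<close>

lemma NEF_member_tilt:
  assumes \<nu>: "\<nu> \<in> MR" and \<theta>: "\<theta> \<in> Theta \<nu>"
  shows "NEF_member (tilt \<theta> \<nu>)"
proof -
  have sets [measurable_cong, simp]: "sets \<nu> = sets borel"
    using \<nu> by (simp add: MR_def radon_measure_def)
  interpret \<nu>: borel_real_measure \<nu> by standard simp
  have fin: "laplace \<nu> t < \<infinity>" if "t \<in> Theta \<nu>" for t
    using that interior_subset unfolding Theta_def by blast
  have "laplace \<nu> \<theta> \<noteq> 0"
    using \<nu> not_AE_False_if_nondegenerate[of \<nu>]
    by (simp add: laplace_def nn_integral_0_iff_AE MR_def)
  then have pos: "enn2real (laplace \<nu> \<theta>) > 0"
    using fin[OF \<theta>] by (simp add: enn2real_positive_iff zero_less_iff_neq_zero)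
  let ?k = "cumulant \<nu> \<theta>"
  have lap: "laplace (tilt \<theta> \<nu>) t = ennreal (exp (- ?k)) * laplace \<nu> (t + \<theta>)" for t
  proof -
    have "laplace (tilt \<theta> \<nu>) t = (\<integral>\<^sup>+x. ennreal (exp (\<theta> * x - ?k)) * ennreal (exp (t * x)) \<partial>\<nu>)"
      unfolding laplace_def tilt_def by (subst nn_integral_density) auto
    also have "\<dots> = (\<integral>\<^sup>+x. ennreal (exp (- ?k)) * ennreal (exp ((t + \<theta>) * x)) \<partial>\<nu>)"
      by (intro nn_integral_cong) (simp add: algebra_simps flip: ennreal_mult exp_add)
    also have "\<dots> = ennreal (exp (- ?k)) * laplace \<nu> (t + \<theta>)"
      unfolding laplace_def by (rule nn_integral_cmult) simp
    finally show ?thesis .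
  qed
  show ?thesis
  proof
    show "sets (tilt \<theta> \<nu>) = sets borel" by (simp add: tilt_def)
    obtain d where d: "d > 0" "\<And>t. \<bar>t - \<theta>\<bar> \<le> d \<Longrightarrow> t \<in> Theta \<nu>"
      using \<nu>.Theta_neighbourhood[OF \<theta>] by blast
    have "ball 0 d \<subseteq> {t. laplace (tilt \<theta> \<nu>) t < \<infinity>}"
    proof
      fix t :: real assume "t \<in> ball 0 d"
      then have "laplace \<nu> (t + \<theta>) < \<infinity>" by (intro fin d) auto
      then show "t \<in> {t. laplace (tilt \<theta> \<nu>) t < \<infinity>}"
        by (simp add: lap ennreal_mult_less_top)
    qed
    then show "0 \<in> Theta (tilt \<theta> \<nu>)"
      unfolding Theta_def using d(1) by (intro interiorI[of "ball 0 d"]) auto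
    have "laplace \<nu> \<theta> = ennreal (enn2real (laplace \<nu> \<theta>))"
      using fin[OF \<theta>] by simp
    then have "laplace (tilt \<theta> \<nu>) 0 = ennreal (exp (- ?k)) * ennreal (enn2real (laplace \<nu> \<theta>))"
      by (simp add: lap)
    also have "\<dots> = ennreal (exp (- ?k) * enn2real (laplace \<nu> \<theta>))"
      by (simp add: ennreal_mult)
    also have "\<dots> = 1"
      using pos by (simp add: cumulant_def exp_minus)
    finally show "laplace (tilt \<theta> \<nu>) 0 = 1" .
    show "\<not> (\<exists>a. AE x in tilt \<theta> \<nu>. x = a)"
    proof -
      have "(AE x in tilt \<theta> \<nu>. x = a) \<longleftrightarrow> (AE x in \<nu>. x = a)" for a
        unfolding tilt_def by (subst AE_density) auto
      then show ?thesis using \<nu> by (simp add: MR_def)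
    qed
  qed
qed

theorem theorem2p1:
  fixes F :: "real measure set" and \<mu> :: "real measure" and m0 :: real
  assumes "is_NEF F" and "\<mu> \<in> F" and "m0 = (\<integral>x. x \<partial>\<mu>)"
  shows "(\<forall>n. \<exists>p :: real poly. degree p = n \<and> (\<forall>x. Pcoeff \<mu> m0 n x = poly p x)) \<and>
         (\<forall>n. Pcoeff \<mu> m0 n \<in> L2_space \<mu>) \<and>
         (\<exists>r>0. \<forall>m. \<bar>m - m0\<bar> < r \<longrightarrow>
            summable (\<lambda>n. L2_norm \<mu> (Pcoeff \<mu> m0 n) * \<bar>m - m0\<bar> ^ n / fact n))"
proof -
  interpret NEF_member \<mu>
    using assms(1,2) NEF_member_tilt by (auto simp: is_NEF_def NEF_of_def)
  show ?thesis
    using Pcoeff_properties[OF assms(3)] by blast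
qed

end
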